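(* Let $f(x)=e^x$, and suppose that the chosen continuous-order derivative family $\{D^r\}_{r\ge 0}$ satisfies $D^r e^x = e^x$ for all real $r\ge 0$ (so that $D^r f(0)=1$ for all $r\ge 0$). Let $$\mathcal S[e^x](x)=\int_0^\infty \frac{D^r f(0)\,x^r}{\Gamma(r+1)}\,dr .$$ Then $$\mathcal S[e^x](x)\sim e^x\qquad\text{as } x\to\infty .$$
   Context: A family $\{D^r\}_{r\ge 0}$ of fractional differentiation operators is called admissible for $f$ if (1) $D^n f(0)=f^{(n)}(0)$ for every integer $n\ge 0$; (2) $D^\alpha D^\beta=D^{\alpha+\beta}$ for $\alpha,\beta\ge 0$; (3) $D^r f(0)$ exists and is finite for every real $r\ge 0$. Here $D^r f(0)$ means $D^r f$ evaluated at $0$. For such a family, and for real $x>0$ such that the integral converges, the spectral reconstruction operator is $$\mathcal S[f](x):=\int_0^\infty \frac{D^r f(0)\,x^r}{\Gamma(r+1)}\,dr,$$ where $\Gamma$ is the Gamma function. The operator depends on the chosen family only through the function $r\mapsto D^r f(0)$. The notation $g(x)\sim h(x)$ as $x\to\infty$ means $g(x)/h(x)\to 1$ as $x\to\infty$ through the reals. *)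

theory Defs
  imports "HOL-Analysis.Analysis" "HOL-Library.Landau_Symbols"
begin

text \<open>
  Differentiation operators act on partial real functions, since \<open>D r f\<close> need not be
  defined everywhere: \<open>D r f x = None\<close> means that \<open>D r f\<close> has no finite value at \<open>x\<close>.
  Only orders \<open>r \<ge> 0\<close> are meaningful; values of a family at negative orders are irrelevant.
\<close>

type_synonym deriv_family = "real \<Rightarrow> (real \<rightharpoonup> real) \<Rightarrow> (real \<rightharpoonup> real)"

definition partial_of :: "(real \<Rightarrow> real) \<Rightarrow> (real \<rightharpoonup> real)" where
  "partial_of f = (\<lambda>x. Some (f x))"

text \<open>
  Since \<^const>\<open>deriv\<close> is total, the existence of all classical derivatives of \<open>f\<close> at \<open>0\<close>,
  implicit in the condition on integer orders, is required separately; the derivative of order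
  \<open>n + 1\<close> at \<open>0\<close> only makes sense if the one of order \<open>n\<close> exists near \<open>0\<close>.
\<close>

definition smooth_at_0 :: "(real \<Rightarrow> real) \<Rightarrow> bool" where
  "smooth_at_0 f \<longleftrightarrow>
     (\<forall>n. \<forall>\<^sub>F x in nhds 0. (deriv ^^ n) f field_differentiable (at x))"

text \<open>The composition law is required on \<open>f\<close>, the function admissibility refers to.\<close>

definition admissible :: "deriv_family \<Rightarrow> (real \<Rightarrow> real) \<Rightarrow> bool" where
  "admissible D f \<longleftrightarrow>
     smooth_at_0 f \<and>
     (\<forall>n::nat. D (real n) (partial_of f) 0 = Some ((deriv ^^ n) f 0)) \<and>
     (\<forall>\<alpha>\<ge>0. \<forall>\<beta>\<ge>0. D \<alpha> (D \<beta> (partial_of f)) = D (\<alpha> + \<beta>) (partial_of f)) \<and>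
     (\<forall>r\<ge>0. D r (partial_of f) 0 \<noteq> None)"

text \<open>
  The Henstock-Kurzweil integral over \<open>{0..}\<close> covers convergent improper integrals.
  The value is meaningful for \<open>x > 0\<close> such that the integral converges, and \<open>0\<close> if it diverges.
\<close>

definition spectral_reconstruction :: "deriv_family \<Rightarrow> (real \<Rightarrow> real) \<Rightarrow> real \<Rightarrow> real" where
  "spectral_reconstruction D f x =
     integral {0..} (\<lambda>r. the (D r (partial_of f) 0) * x powr r / Gamma (r + 1))"

end

theory Submission
  imports Defs "HOL-Real_Asymp.Real_Asymp"
begin

text \<open>
  Cutting \<open>{0..}\<close> into unit intervals turns the integral of \<open>x powr r / Gamma (r + 1)\<close> into the
  integral over \<open>s \<in> {0..1}\<close> of \<open>frac_exp s x = (\<Sum>n. x powr (s + n) / Gamma (s + n + 1))\<close>. Since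
  \<open>frac_exp s\<close> solves \<open>y' = y + x powr (s - 1) / Gamma s\<close>, the quantity \<open>exp (-x) * frac_exp s x\<close> is the
  regularised lower incomplete Gamma function, which lies between \<open>1 - exp (-x) / Gamma s\<close> and
  \<open>1\<close> for \<open>s \<in> {0<..1}\<close> and \<open>x \<ge> 1\<close>. As \<open>1 / Gamma\<close> is bounded on \<open>{0..1}\<close>, the integral differs
  from \<open>exp x\<close> by a bounded amount.
\<close>

section \<open>Decay of the reciprocal Gamma function\<close>

lemma rGamma_real_nonneg: "x \<ge> 0 \<Longrightarrow> rGamma (x::real) \<ge> 0"
  by (cases "x = 0") (auto simp: rGamma_inverse_Gamma less_imp_le)

text \<open>Each step of the recurrence \<open>z * rGamma (z + 1) = rGamma z\<close> divides by some
  \<open>s + 1 + n\<close>, which is at least \<open>n + 1\<close>. This makes the exponential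
  series a majorant of the series defining \<open>frac_exp\<close>.\<close>

lemma rGamma_shift_le:
  assumes "s \<ge> (0::real)"
  shows "rGamma (s + 1 + real n) \<le> rGamma (s + 1) / fact n"
proof (induction n)
  case (Suc n)
  let ?z = "s + 1 + real n"
  have z: "real (Suc n) \<le> ?z" using assms by simp
  have "?z * rGamma (?z + 1) = rGamma ?z" by (rule rGamma_plus1)
  moreover have "real (Suc n) * rGamma (?z + 1) \<le> ?z * rGamma (?z + 1)"
    using z assms by (intro mult_right_mono rGamma_real_nonneg) auto
  ultimately have "real (Suc n) * rGamma (?z + 1) \<le> rGamma (s + 1) / fact n"
    using Suc.IH by linarith
  then have "rGamma (?z + 1) * (real (Suc n) * fact n) \<le> rGamma (s + 1)"
    by (simp add: pos_le_divide_eq mult_ac)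
  then show ?case
    unfolding pos_le_divide_eq[OF fact_gt_zero] by (simp add: algebra_simps)
qed simp

lemma summable_frac_exp_coeffs:
  assumes "s \<ge> (0::real)"
  shows "summable (\<lambda>n. rGamma (s + 1 + real n) * x ^ n)"
proof (rule summable_comparison_test')
  show "summable (\<lambda>n. rGamma (s + 1) * (inverse (fact n) * \<bar>x\<bar> ^ n))"
    by (intro summable_mult summable_exp)
  show "norm (rGamma (s + 1 + real n) * x ^ n) \<le> rGamma (s + 1) * (inverse (fact n) * \<bar>x\<bar> ^ n)"
    for n
    using mult_right_mono[OF rGamma_shift_le[OF assms, of n], of "\<bar>x\<bar> ^ n"] assms
    by (simp add: abs_mult power_abs rGamma_real_nonneg field_simps)
qed

section \<open>The fractional exponential series and its differential equation\<close>

text \<open>The sum is the Mittag-Leffler function with parameters \<open>1\<close> and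
  \<open>s + 1\<close>. Factoring out \<open>x powr s\<close> leaves a genuine power series, which
  can be differentiated termwise. Since \<open>0 powr 0 = 0\<close>, the value at
  \<open>x = 0\<close> is \<open>0\<close> even for \<open>s = 0\<close>.\<close>

definition frac_exp :: "real \<Rightarrow> real \<Rightarrow> real" where
  "frac_exp s x = x powr s * (\<Sum>n. rGamma (s + 1 + real n) * x ^ n)"

lemma frac_exp_sums:
  assumes "s \<ge> 0" "x > 0"
  shows "(\<lambda>n. x powr (s + real n) * rGamma (s + real n + 1)) sums frac_exp s x"
  using sums_mult[OF summable_sums[OF summable_frac_exp_coeffs[OF assms(1), of x]], of "x powr s"] assms
  by (simp add: frac_exp_def powr_add powr_realpow algebra_simps)

lemma frac_exp_0: "x > 0 \<Longrightarrow> frac_exp 0 x = exp x"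
  by (simp add: frac_exp_def exp_def rGamma_inverse_Gamma Gamma_fact scaleR_conv_of_real)

text \<open>Multiplying the recurrence for the coefficients by \<open>x ^ n\<close> and summing
  gives a first-order equation for the power series \<open>A\<close>; the inhomogeneous term comes
  from \<open>n = 0\<close>.\<close>

lemma frac_exp_has_field_derivative:
  assumes s: "s > 0" and x: "x > 0"
  shows "(frac_exp s has_field_derivative frac_exp s x + x powr (s - 1) * rGamma s) (at x)"
proof -
  define c where "c n = rGamma (s + 1 + real n)" for n
  define A where "A x = (\<Sum>n. c n * x ^ n)" for x
  define A' where "A' = (\<Sum>n. diffs c n * x ^ n)"
  have summ: "summable (\<lambda>n. c n * y ^ n)" for y
    unfolding c_def using s by (intro summable_frac_exp_coeffs) auto
  have dA: "(A has_field_derivative A') (at x)"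
    unfolding A_def A'_def by (rule termdiffs_strong_converges_everywhere[OF summ])
  have "(\<lambda>n. of_nat n * c n * x ^ (n - Suc 0)) sums A'"
    unfolding A'_def by (rule diffs_equiv[OF termdiff_converges_all[OF summ]])
  from sums_mult[OF this, of x] have "(\<lambda>n. real n * c n * x ^ n) sums (x * A')"
    by (rule sums_cong[THEN iffD1, rotated]) (case_tac n; simp add: algebra_simps)
  from sums_add[OF this sums_mult[OF summable_sums[OF summ], of s x]]
  have 1: "(\<lambda>n. (s + real n) * c n * x ^ n) sums (x * A' + s * A x)"
    by (simp add: A_def algebra_simps)
  \<comment> \<open>The predecessor of \<open>c 0\<close> is \<open>rGamma s\<close>, which
    truncated subtraction in \<open>c (n - 1)\<close> would miss.\<close>
  have rec: "(s + real n) * c n = (if n = 0 then rGamma s else c (n - 1))" for n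
    using rGamma_plus1[of "s + real n"] by (cases n) (auto simp: c_def algebra_simps)
  have "(\<lambda>n. (if Suc n = 0 then rGamma s else c (Suc n - 1)) * x ^ Suc n) sums (x * A x)"
    using sums_mult[OF summable_sums[OF summ], of x x] by (simp add: A_def algebra_simps)
  from sums_Suc[OF this] have "(\<lambda>n. (s + real n) * c n * x ^ n) sums (x * A x + rGamma s)"
    by (simp add: rec)
  with 1 have eq: "x * A' + s * A x = x * A x + rGamma s"
    by (rule sums_unique2)
  have "((\<lambda>x. x powr s * A x) has_field_derivative (s * x powr (s - 1) * A x + A' * x powr s)) (at x)"
    using DERIV_mult[OF has_real_derivative_powr[OF x] dA] .
  moreover have "s * x powr (s - 1) * A x + A' * x powr s = x powr (s - 1) * (x * A' + s * A x)"
    using x by (simp add: powr_diff field_simps)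
  moreover have "\<dots> = x powr s * A x + x powr (s - 1) * rGamma s"
    using x unfolding eq by (simp add: powr_diff field_simps)
  moreover have "frac_exp s = (\<lambda>x. x powr s * A x)"
    by (auto simp: fun_eq_iff frac_exp_def A_def c_def)
  ultimately show ?thesis by simp
qed

section \<open>Incomplete Gamma integral and two-sided bounds\<close>

lemma continuous_on_frac_exp:
  assumes "s > 0"
  shows "continuous_on {0..} (frac_exp s)"
proof -
  have "isCont (\<lambda>x. \<Sum>n. rGamma (s + 1 + real n) * x ^ n) x" for x
    using assms by (intro isCont_powser_converges_everywhere summable_frac_exp_coeffs) auto
  then have "continuous_on {0..} (\<lambda>x. \<Sum>n. rGamma (s + 1 + real n) * x ^ n)"
    by (simp add: continuous_at_imp_continuous_on)
  then show ?thesis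
    unfolding frac_exp_def using assms by (intro continuous_intros continuous_on_powr') auto
qed

text \<open>The integrating factor \<open>exp (-x)\<close> removes the homogeneous part of the
  differential equation, and \<open>frac_exp s 0 = 0\<close>.\<close>

lemma frac_exp_has_integral:
  assumes s: "s > 0" and x: "x > 0"
  shows "((\<lambda>t. t powr (s - 1) / exp t * rGamma s) has_integral exp (-x) * frac_exp s x) {0..x}"
proof -
  have "((\<lambda>t. t powr (s - 1) / exp t * rGamma s) has_integral
          (exp (-x) * frac_exp s x - exp (-0) * frac_exp s 0)) {0..x}"
  \<comment> \<open>For \<open>s < 1\<close> the integrand is unbounded near \<open>0\<close>, so
    differentiability is used only in the interior.\<close>
  proof (rule fundamental_theorem_of_calculus_interior)
    show "continuous_on {0..x} (\<lambda>x. exp (-x) * frac_exp s x)"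
      by (intro continuous_intros continuous_on_subset[OF continuous_on_frac_exp[OF s]]) auto
    fix t assume "t \<in> {0<..<x}"
    then have "((\<lambda>x. exp (-x) * frac_exp s x) has_field_derivative t powr (s - 1) / exp t * rGamma s) (at t)"
      using s by (auto intro!: derivative_eq_intros frac_exp_has_field_derivative
          simp: exp_minus field_simps)
    then show "((\<lambda>x. exp (-x) * frac_exp s x) has_vector_derivative t powr (s - 1) / exp t * rGamma s) (at t)"
      by (simp add: has_real_derivative_iff_has_vector_derivative)
  qed (use x in auto)
  then show ?thesis using s by (simp add: frac_exp_def)
qed

text \<open>The integral over all of \<open>{0..}\<close> is \<open>1\<close> by Euler's formula.
  The part beyond \<open>x\<close> is nonnegative and at most \<open>exp (-x) * rGamma s\<close>,
  because \<open>t powr (s - 1) \<le> 1\<close> for \<open>t \<ge> 1\<close> and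
  \<open>s \<le> 1\<close>.\<close>

lemma frac_exp_bounds:
  assumes s: "0 < s" "s \<le> 1" and x: "x \<ge> 1"
  shows "frac_exp s x \<le> exp x" "exp x - rGamma s \<le> frac_exp s x"
proof -
  let ?h = "\<lambda>t. t powr (s - 1) / exp t * rGamma s"
  have r: "rGamma s \<ge> 0" using s by (simp add: rGamma_real_nonneg)
  have low: "(?h has_integral exp (-x) * frac_exp s x) {0..x}"
    using frac_exp_has_integral s x by simp
  have tot: "(?h has_integral 1) {0..}"
    using has_integral_mult_left[OF Gamma_integral_real[OF s(1)], of "rGamma s"]
      Gamma_real_pos[OF s(1)]
    by (simp add: rGamma_inverse_Gamma)
  have "exp (-x) * frac_exp s x \<le> 1"
    using has_integral_subset_le[OF _ low tot] r by auto
  then show "frac_exp s x \<le> exp x" by (simp add: exp_minus field_simps)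
  have E: "((\<lambda>t. exp (-t) * rGamma s) has_integral exp (-x) * rGamma s) {x..}"
    using has_integral_mult_left[OF has_integral_exp_minus_to_infinity[of 1 x]] by simp
  \<comment> \<open>A majorant of \<open>?h\<close> on the half-line: \<open>?h\<close> itself up to
    \<open>x\<close>, the pure exponential beyond.\<close>
  have "((\<lambda>t. if t \<in> {0..x} then ?h t else exp (-t) * rGamma s) has_integral
      (exp (-x) * frac_exp s x + exp (-x) * rGamma s)) ({0..x} \<union> {x..})"
  proof (rule has_integral_Un)
    show "((\<lambda>t. if t \<in> {0..x} then ?h t else exp (-t) * rGamma s) has_integral
      exp (-x) * frac_exp s x) {0..x}"
      using low by (rule has_integral_eq[rotated]) auto
    show "((\<lambda>t. if t \<in> {0..x} then ?h t else exp (-t) * rGamma s) has_integral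
      exp (-x) * rGamma s) {x..}"
      using E by (rule has_integral_spike[of "{x}", rotated 2]) auto
    have "{0..x} \<inter> {x..} = {x}" using x by auto
    then show "negligible ({0..x} \<inter> {x..})" by simp
  qed
  moreover have "{0..x} \<union> {x..} = {0..}" using x by auto
  ultimately have "1 \<le> exp (-x) * frac_exp s x + exp (-x) * rGamma s"
  proof (rule_tac has_integral_le[OF tot])
    show "?h t \<le> (if t \<in> {0..x} then ?h t else exp (-t) * rGamma s)" if "t \<in> {0..}" for t
    proof (cases "t \<le> x")
      case False
      then have "t powr (s - 1) \<le> t powr 0" using x s by (intro powr_mono) auto
      then have "t powr (s - 1) \<le> 1" using x False by simp
      then have "t powr (s - 1) * (exp (-t) * rGamma s) \<le> exp (-t) * rGamma s"
        using r by (intro mult_left_le_one_le) auto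
      then show ?thesis using False by (simp add: exp_minus field_simps)
    qed (use that in auto)
  qed auto
  then show "exp x - rGamma s \<le> frac_exp s x" by (simp add: exp_minus field_simps)
qed

section \<open>Integrals over the half-line by unit shifts\<close>

lemma integral_unit_shifts:
  fixes f :: "real \<Rightarrow> real"
  assumes "continuous_on {0..} f"
  shows "integral {0..real k} f = integral {0..1} (\<lambda>s. \<Sum>n<k. f (s + real n))"
proof (induction k)
  case (Suc k)
  have int: "f integrable_on {a..b}" if "a \<ge> 0" for a b
    using that by (intro integrable_continuous_interval continuous_on_subset[OF assms]) auto
  have shift: "(\<lambda>s. f (s + real n)) integrable_on {0..1}" for n
    using integrable_shift_real_ivl[OF int[of "real n" "real n + 1"], of "real n"] by simp
  have "integral {0..real (Suc k)} f = integral {0..real k} f + integral {real k..real (Suc k)} f"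
    by (rule Henstock_Kurzweil_Integration.integral_combine[symmetric]) (auto intro: int)
  also have "integral {real k..real (Suc k)} f = integral {0..1} (\<lambda>s. f (s + real k))"
    using integral_shift_real_ivl[of "real k" "real k" "real k + 1" f] by (simp add: add.commute)
  finally show ?case
    using Suc.IH shift by (simp add: Henstock_Kurzweil_Integration.integral_add integrable_sum)
qed simp

text \<open>Monotone convergence is applied twice: to the partial sums on \<open>{0..1}\<close>,
  whose integrals are bounded by \<open>B\<close>, and to the truncations of \<open>f\<close> to
  \<open>{0..k}\<close>. The \<open>has_integral\<close> form records that the improper integral
  converges, so its value is not a default \<open>0\<close>.\<close>

lemma has_integral_atLeast_unit_shifts:
  fixes f g :: "real \<Rightarrow> real"
  assumes cont: "continuous_on {0..} f" and nonneg: "\<And>r. r \<ge> 0 \<Longrightarrow> f r \<ge> 0"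
    and sums: "\<And>s. s \<in> {0..1} \<Longrightarrow> (\<lambda>n. f (s + real n)) sums g s"
    and le: "\<And>s. s \<in> {0..1} \<Longrightarrow> g s \<le> B"
  shows "g integrable_on {0..1}" "(f has_integral integral {0..1} g) {0..}"
proof -
  let ?S = "\<lambda>k s. \<Sum>n<k. f (s + real n)"
  have int: "f integrable_on {a..b}" if "a \<ge> 0" for a b
    using that by (intro integrable_continuous_interval continuous_on_subset[OF cont]) auto
  have S: "?S k integrable_on {0..1}" for k
  proof (intro integrable_sum)
    show "(\<lambda>s. f (s + real n)) integrable_on {0..1}" for n
      using integrable_shift_real_ivl[OF int[of "real n" "real n + 1"], of "real n"] by simp
  qed auto
  have Sle: "?S k s \<le> B" if "s \<in> {0..1}" for k s
    using sum_le_suminf[OF sums_summable[OF sums[OF that]], of "{..<k}"] sums_unique[OF sums[OF that]]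
      le[OF that] nonneg that by force
  have bnd: "norm (integral {0..1} (?S k)) \<le> B" for k
  proof -
    have "integral {0..1} (?S k) \<le> integral {0..1} (\<lambda>_::real. B)"
      by (intro integral_le S Sle) auto
    moreover have "integral {0..1} (?S k) \<ge> 0"
      by (intro integral_nonneg S sum_nonneg nonneg) auto
    ultimately show ?thesis by simp
  qed
  have conv: "g integrable_on {0..1} \<and> (\<lambda>k. integral {0..1} (?S k)) \<longlonglongrightarrow> integral {0..1} g"
  proof (rule monotone_convergence_increasing[OF S])
    show "(\<lambda>k. ?S k s) \<longlonglongrightarrow> g s" if "s \<in> {0..1}" for s
      using sums[OF that] by (simp add: sums_def)
    show "bounded (range (\<lambda>k. integral {0..1} (?S k)))"
      using bnd by (intro boundedI[of _ B]) auto
  qed (use nonneg in auto)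
  then show "g integrable_on {0..1}" ..
  have lim: "(\<lambda>k. integral {0..real k} f) \<longlonglongrightarrow> integral {0..1} g"
    using conv integral_unit_shifts[OF cont] by simp
  show "(f has_integral integral {0..1} g) {0..}"
  proof (rule has_integral_monotone_convergence_increasing[OF _ _ _ lim])
    show "((\<lambda>r. if r \<in> {0..real k} then f r else 0) has_integral integral {0..real k} f) {0..}" for k
      using int by (subst has_integral_restrict) auto
    show "(\<lambda>k. if r \<in> {0..real k} then f r else 0) \<longlonglongrightarrow> f r" if "r \<in> {0..}" for r
    proof (rule tendsto_eventually)
      show "\<forall>\<^sub>F k in sequentially. (if r \<in> {0..real k} then f r else 0) = f r"
        using eventually_ge_at_top[of "nat \<lceil>r\<rceil>"] by eventually_elim (use that in auto)
    qed
  qed (use nonneg in auto)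
qed

text \<open>\<open>C\<close> bounds \<open>rGamma\<close> on the compact interval
  \<open>{0..1}\<close>, so the bounds on \<open>frac_exp s x\<close> become uniform in
  \<open>s\<close> and survive integration over an interval of length one.\<close>

lemma integral_powr_over_Gamma_bounds:
  "\<exists>C::real. \<forall>x\<ge>1. integral {0..} (\<lambda>r. x powr r / Gamma (r + 1)) \<in> {exp x - C..exp x}"
proof -
  have "compact (rGamma ` {0..1::real})"
    by (intro compact_continuous_image continuous_on_rGamma) auto
  then obtain C where C: "\<And>s. s \<in> {0..1::real} \<Longrightarrow> rGamma s \<le> C"
    by (metis (no_types, lifting) bounded_imp_bdd_above compact_imp_bounded bdd_above.unfold image_eqI)
  have "integral {0..} (\<lambda>r. x powr r / Gamma (r + 1)) \<in> {exp x - C..exp x}" if x: "x \<ge> 1" for x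
  proof -
    let ?f = "\<lambda>r. x powr r * rGamma (r + 1)"
    have cont: "continuous_on {0..} ?f"
      by (intro continuous_intros continuous_on_compose2[OF continuous_on_rGamma[of UNIV]])
        (use x in auto)
    have nonneg: "?f r \<ge> 0" if "r \<ge> 0" for r
      using that by (intro mult_nonneg_nonneg rGamma_real_nonneg) auto
    have sums: "(\<lambda>n. ?f (s + real n)) sums frac_exp s x" if "s \<in> {0..1}" for s
      using frac_exp_sums that x by simp
    have bounds: "frac_exp s x \<le> exp x" "exp x - C \<le> frac_exp s x" if "s \<in> {0..1}" for s
      \<comment> \<open>The endpoint \<open>s = 0\<close> is separate: there \<open>frac_exp\<close>
        equals \<open>exp x\<close>, and \<open>rGamma 0 = 0\<close> yields
        \<open>C \<ge> 0\<close>.\<close>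
      using frac_exp_bounds[of s x] frac_exp_0[of x] C[OF that] C[of 0] that x
      by (cases "s = 0"; force)+
    note F = has_integral_atLeast_unit_shifts[OF cont nonneg sums bounds(1)]
    have "integral {0..1} (\<lambda>s. frac_exp s x) \<le> integral {0..1} (\<lambda>_::real. exp x)"
      by (intro integral_le F(1) bounds) auto
    moreover have "integral {0..1} (\<lambda>_::real. exp x - C) \<le> integral {0..1} (\<lambda>s. frac_exp s x)"
      by (intro integral_le F(1) bounds) auto
    ultimately show ?thesis
      using integral_unique[OF F(2)] by (simp add: rGamma_inverse_Gamma divide_inverse)
  qed
  then show ?thesis by blast
qed

theorem proposition2p2:
  fixes D :: deriv_family
  assumes "admissible D exp"
    and "\<And>r. r \<ge> 0 \<Longrightarrow> D r (partial_of exp) = partial_of exp"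
  shows "spectral_reconstruction D exp \<sim>[at_top] exp"
proof -
  obtain C :: real where
    C: "\<forall>x\<ge>1. integral {0..} (\<lambda>r. x powr r / Gamma (r + 1)) \<in> {exp x - C..exp x}"
    using integral_powr_over_Gamma_bounds ..
  have D: "D r (partial_of exp) 0 = Some 1" if "r \<ge> 0" for r
    unfolding assms(2)[OF that] by (simp add: partial_of_def)
  have S: "spectral_reconstruction D exp x = integral {0..} (\<lambda>r. x powr r / Gamma (r + 1))" for x
    unfolding spectral_reconstruction_def
    by (rule Henstock_Kurzweil_Integration.integral_cong) (simp add: D)
  have bounds: "\<forall>\<^sub>F x in at_top. spectral_reconstruction D exp x \<in> {exp x - C..exp x}"
    unfolding S using C by (intro eventually_at_top_linorderI[of 1]) blast
  \<comment> \<open>A bounded error is negligible against \<open>exp x\<close>, so both ends of the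
    sandwich are asymptotic to it.\<close>
  have "(\<lambda>x. exp x - C) \<sim>[at_top] (\<lambda>x. exp x)" by real_asymp
  then show ?thesis
    by (rule asymp_equiv_sandwich_real[OF _ asymp_equiv_refl bounds])
qed

end
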